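(* If $X$ is a multigraph with maximum valency $d>1$, then its complete generalized truncation $Y$ satisfies $\chi(Y)=d$.
   Context: A multigraph may have multiple edges but no loops; it is assumed to have no isolated vertices. Generalized truncation of $X$: take a matching $M_0$ with $|M_0|=|E(X)|$ (on $2|E(X)|$ new vertices) and a bijection $F:E(X)\to M_0$; for each edge $e$ of $X$ with ends $u,v$, label one end of $F(e)$ by $u$ and the other by $v$. For $v\in V(X)$, the cluster $\mathrm{cl}(v)$ is the set of vertices labelled $v$; insert a graph $\mathrm{con}(v)$ on $\mathrm{cl}(v)$. The result is the complete generalized truncation when every $\mathrm{con}(v)$ is a complete graph. $\chi$ denotes the chromatic number. *)

theory Defs
  imports Main "HOL-Library.Extended_Nat"
begin

record ('v, 'e) mgraph =
  mverts :: "'v set"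
  medges :: "'e set"
  ends :: "'e \<Rightarrow> 'v set"

definition multigraph :: "('v, 'e) mgraph \<Rightarrow> bool" where
  "multigraph X \<longleftrightarrow>
     (\<forall>e\<in>medges X. ends X e \<subseteq> mverts X \<and> card (ends X e) = 2) \<and>
     (\<forall>v\<in>mverts X. \<exists>e\<in>medges X. v \<in> ends X e)"

definition incident_edges :: "('v, 'e) mgraph \<Rightarrow> 'v \<Rightarrow> 'e set" where
  "incident_edges X v = {e \<in> medges X. v \<in> ends X e}"

definition valency :: "('v, 'e) mgraph \<Rightarrow> 'v \<Rightarrow> nat" where
  "valency X v = card (incident_edges X v)"

text \<open>Since the cardinality of an infinite set is 0, finiteness of every valency is
  required explicitly. The multigraph itself need not be finite.\<close>

definition has_max_valency :: "('v, 'e) mgraph \<Rightarrow> nat \<Rightarrow> bool" where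
  "has_max_valency X d \<longleftrightarrow>
     (\<forall>v\<in>mverts X. finite (incident_edges X v) \<and> valency X v \<le> d) \<and>
     (\<exists>v\<in>mverts X. valency X v = d)"

record 'a sgraph =
  sverts :: "'a set"
  sedges :: "'a set set"

definition simple_graph :: "'a sgraph \<Rightarrow> bool" where
  "simple_graph G \<longleftrightarrow> (\<forall>e\<in>sedges G. e \<subseteq> sverts G \<and> card e = 2)"

definition complete_graph :: "'a sgraph \<Rightarrow> bool" where
  "complete_graph G \<longleftrightarrow>
     simple_graph G \<and> (\<forall>x\<in>sverts G. \<forall>y\<in>sverts G. x \<noteq> y \<longrightarrow> {x, y} \<in> sedges G)"

definition matching :: "'a set set \<Rightarrow> bool" where
  "matching M \<longleftrightarrow> (\<forall>e\<in>M. card e = 2) \<and> (\<forall>e\<in>M. \<forall>f\<in>M. e \<noteq> f \<longrightarrow> e \<inter> f = {})"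

definition cluster :: "'a set set \<Rightarrow> ('a \<Rightarrow> 'v) \<Rightarrow> 'v \<Rightarrow> 'a set" where
  "cluster M lab v = {x \<in> \<Union>M. lab x = v}"

text \<open>As \<open>F e\<close> and \<open>ends X e\<close> both have two elements, \<open>lab ` F e = ends X e\<close> says that the two
  ends of \<open>F e\<close> are labelled by the two ends of \<open>e\<close>, one each.\<close>

definition generalized_truncation ::
    "('v, 'e) mgraph \<Rightarrow> 'a set set \<Rightarrow> ('e \<Rightarrow> 'a set) \<Rightarrow> ('a \<Rightarrow> 'v) \<Rightarrow> ('v \<Rightarrow> 'a sgraph)
      \<Rightarrow> 'a sgraph \<Rightarrow> bool" where
  "generalized_truncation X M F lab con Y \<longleftrightarrow>
     matching M \<and> bij_betw F (medges X) M \<and>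
     (\<forall>e\<in>medges X. lab ` F e = ends X e) \<and>
     (\<forall>v\<in>mverts X. simple_graph (con v) \<and> sverts (con v) = cluster M lab v) \<and>
     sverts Y = \<Union>M \<and>
     sedges Y = M \<union> (\<Union>v\<in>mverts X. sedges (con v))"

definition complete_generalized_truncation :: "('v, 'e) mgraph \<Rightarrow> 'a sgraph \<Rightarrow> bool" where
  "complete_generalized_truncation X Y \<longleftrightarrow>
     (\<exists>M F lab con. generalized_truncation X M F lab con Y \<and>
        (\<forall>v\<in>mverts X. complete_graph (con v)))"

definition proper_colouring :: "'a sgraph \<Rightarrow> nat \<Rightarrow> ('a \<Rightarrow> nat) \<Rightarrow> bool" where
  "proper_colouring G k c \<longleftrightarrow>
     (\<forall>x\<in>sverts G. c x < k) \<and>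
     (\<forall>x\<in>sverts G. \<forall>y\<in>sverts G. {x, y} \<in> sedges G \<longrightarrow> c x \<noteq> c y)"

text \<open>The value is \<open>\<infinity>\<close> if no finite number of colours suffices.\<close>

definition chromatic_number :: "'a sgraph \<Rightarrow> enat" where
  "chromatic_number G = Inf {enat k | k. \<exists>c. proper_colouring G k c}"

lemma complete_generalized_truncation_exists:
  fixes X :: "('v, 'e) mgraph"
  assumes "multigraph X"
  shows "\<exists>Y :: ('v \<times> 'e) sgraph. complete_generalized_truncation X Y"
proof -
  define F :: "'e \<Rightarrow> ('v \<times> 'e) set" where "F = (\<lambda>e. ends X e \<times> {e})"
  define M where "M = F ` medges X"
  define con :: "'v \<Rightarrow> ('v \<times> 'e) sgraph" where
    "con = (\<lambda>v. \<lparr>sverts = cluster M fst v, sedges = {e. e \<subseteq> cluster M fst v \<and> card e = 2}\<rparr>)"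
  define Y where "Y = \<lparr>sverts = \<Union>M, sedges = M \<union> (\<Union>v\<in>mverts X. sedges (con v))\<rparr>"
  have two: "card (ends X e) = 2" if "e \<in> medges X" for e
    using assms that by (auto simp: multigraph_def)
  have ne: "ends X e \<noteq> {}" if "e \<in> medges X" for e
    using two[OF that] by auto
  have inj: "inj_on F (medges X)"
    by (rule inj_onI) (use ne in \<open>auto simp: F_def times_eq_iff\<close>)
  have "matching M"
    by (auto simp: matching_def M_def F_def two card_cartesian_product)
  moreover have "bij_betw F (medges X) M"
    using inj by (simp add: M_def bij_betw_def)
  moreover have "\<forall>e\<in>medges X. fst ` F e = ends X e"
    by (auto simp: F_def)
  moreover have "\<forall>v. complete_graph (con v) \<and> simple_graph (con v) \<and> sverts (con v) = cluster M fst v"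
    by (auto simp: con_def complete_graph_def simple_graph_def)
  ultimately have "generalized_truncation X M F fst con Y \<and> (\<forall>v\<in>mverts X. complete_graph (con v))"
    by (simp add: generalized_truncation_def Y_def)
  then show ?thesis
    unfolding complete_generalized_truncation_def by blast
qed

end

theory Submission
  imports Defs
begin

text \<open>
  The union of two matchings, even an infinite one, is bipartite. To colour \<open>Y\<close> with \<open>d\<close> colours,
  induct on the bound \<open>d \<ge> 2\<close> on the cluster sizes: choose one pair of vertices in every cluster
  with at least two vertices, and two-colour the union of the matching \<open>M\<close> with these pairs. If
  \<open>d = 2\<close> this is already a proper colouring. Otherwise, the vertices of the first colour in the
  chosen pairs are independent in \<open>M\<close> and meet every cluster of maximal size, so they may share
  one colour, and removing them lowers the bound on the cluster sizes by one. Conversely, the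
  cluster of a vertex of maximum valency is a clique with \<open>d\<close> vertices.
\<close>

section \<open>Bipartiteness of the union of two matchings\<close>

text \<open>Each component under \<open>m\<close> and \<open>p\<close> consists of two orbits of
  \<open>p \<circ> m\<close>, and both involutions exchange these. Choosing one of the two orbits
  per component and testing membership in it gives \<open>s\<close>; no finiteness is
  involved.\<close>

lemma fixpoint_free_involutions_bipartite:
  fixes m p :: "'a \<Rightarrow> 'a"
  assumes mm: "\<And>x. m (m x) = x" and pp: "\<And>x. p (p x) = x"
    and mf: "\<And>x. m x \<noteq> x" and pf: "\<And>x. p x \<noteq> x"
  shows "\<exists>s :: 'a \<Rightarrow> bool. \<forall>x. s (m x) \<noteq> s x \<and> s (p x) \<noteq> s x"
proof -
  define r where "r = p \<circ> m"
  \<comment> \<open>This is the orbit under all integer powers of the bijection \<open>r\<close>,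
    with natural powers on both sides in place of an inverse.\<close>
  define orb where "orb = (\<lambda>x. {y. \<exists>a b. (r ^^ a) x = (r ^^ b) y})"
  have "inj r"
    unfolding r_def by (rule injI) (metis comp_apply mm pp)
  then have inj: "inj (r ^^ n)" for n
    by (rule inj_fn)
  have orb_refl: "x \<in> orb x" for x
    by (auto simp: orb_def)
  have orb_sym: "y \<in> orb x \<Longrightarrow> x \<in> orb y" for x y
    by (auto simp: orb_def) metis
  have orb_trans: "z \<in> orb x" if "y \<in> orb x" "z \<in> orb y" for x y z
  proof -
    from that obtain a b a' b'
      where "(r ^^ a) x = (r ^^ b) y" "(r ^^ a') y = (r ^^ b') z"
      by (auto simp: orb_def)
    then have "(r ^^ (a' + a)) x = (r ^^ (b + b')) z"
      by (metis add.commute comp_apply funpow_add)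
    then show ?thesis
      unfolding orb_def by blast
  qed
  have orb_eq: "orb x = orb y" if "y \<in> orb x" for x y
    using that orb_sym orb_trans by blast
  \<comment> \<open>The induction goes in steps of two: cancelling \<open>p\<close> and
    \<open>m\<close> turns a counterexample for \<open>n + 2\<close> at \<open>x\<close> into one
    for \<open>n\<close> at \<open>r x\<close>. The base cases are the absence of fixed points of
    \<open>m\<close> and of \<open>p\<close>.\<close>
  have no: "(r ^^ n) x \<noteq> m x" for n x
  proof (induction n arbitrary: x rule: induct_nat_012)
    case 0
    then show ?case using mf[of x] by simp
  next
    case 1
    then show ?case using pf[of "m x"] by (simp add: r_def)
  next
    case (ge2 n)
    show ?case
    proof
      assume "(r ^^ Suc (Suc n)) x = m x"
      then have "r ((r ^^ n) (r x)) = m x"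
        by (simp add: funpow_swap1)
      then have "(r ^^ n) (r x) = m (r x)"
        unfolding r_def by (metis comp_apply mm pp)
      with ge2(1) show False by blast
    qed
  qed
  have m_notin: "m x \<notin> orb x" for x
  proof
    assume "m x \<in> orb x"
    then obtain a b where ab: "(r ^^ a) x = (r ^^ b) (m x)"
      by (auto simp: orb_def)
    show False
    proof (cases "b \<le> a")
      case True
      then have "(r ^^ b) ((r ^^ (a - b)) x) = (r ^^ b) (m x)"
        using ab by (metis comp_apply funpow_add le_add_diff_inverse)
      with no inj show False by (metis injD)
    next
      case False
      then have "(r ^^ a) ((r ^^ (b - a)) (m x)) = (r ^^ a) x"
        using ab by (metis comp_apply funpow_add le_add_diff_inverse nat_le_linear)
      \<comment> \<open>After cancelling \<open>r ^^ a\<close>, the point \<open>x\<close> is read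
        as \<open>m (m x)\<close>, which is excluded by \<open>no\<close> at
        \<open>m x\<close>.\<close>
      with no[of "b - a" "m x"] inj mm show False by (metis injD)
    qed
  qed
  have "p x \<in> orb (m x)" for x
    unfolding orb_def
    by (rule CollectI, rule exI[of _ 1], rule exI[of _ 0]) (simp add: r_def mm)
  then have op: "orb (p x) = orb (m x)" for x
    using orb_eq by blast
  have "x \<in> orb (m (p x))" for x
    unfolding orb_def
    by (rule CollectI, rule exI[of _ 1], rule exI[of _ 0]) (simp add: r_def mm pp)
  then have omp: "orb (m (p x)) = orb x" for x
    using orb_eq by blast
  \<comment> \<open>The choice is made from an unordered pair of orbits, which is the same set for
    \<open>x\<close>, \<open>m x\<close> and \<open>p x\<close>; hence it is constant on
    components.\<close>
  define T where "T = (\<lambda>x. SOME S. S \<in> {orb x, orb (m x)})"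
  have T_in: "T x \<in> {orb x, orb (m x)}" for x
    unfolding T_def by (rule someI[of _ "orb x"]) simp
  have Tm: "T (m x) = T x" and Tp: "T (p x) = T x" for x
    unfolding T_def mm op omp by (simp_all only: insert_commute)
  have "(m x \<in> T x) \<noteq> (x \<in> T x)" for x
    using T_in[of x] m_notin[of x] orb_refl orb_sym by blast
  moreover have "p x \<in> T x \<longleftrightarrow> m x \<in> T x" for x
    using T_in[of x] op[of x] orb_refl[of "p x"] orb_refl[of "m x"] orb_eq by blast
  ultimately have "\<forall>x. (m x \<in> T (m x)) \<noteq> (x \<in> T x) \<and> (p x \<in> T (p x)) \<noteq> (x \<in> T x)"
    by (simp add: Tm Tp)
  then show ?thesis by (rule exI[of _ "\<lambda>x. x \<in> T x"])
qed

text \<open>Joining the two copies of each fixed point in a doubled vertex set removes the fixed points.\<close>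

lemma involutions_bipartite:
  fixes m p :: "'a \<Rightarrow> 'a"
  assumes "\<And>x. m (m x) = x" and "\<And>x. p (p x) = x"
  shows "\<exists>s :: 'a \<Rightarrow> bool.
    \<forall>x. (m x \<noteq> x \<longrightarrow> s (m x) \<noteq> s x) \<and> (p x \<noteq> x \<longrightarrow> s (p x) \<noteq> s x)"
proof -
  define lift :: "('a \<Rightarrow> 'a) \<Rightarrow> 'a \<times> bool \<Rightarrow> 'a \<times> bool"
    where "lift f = (\<lambda>(x, b). if f x = x then (x, \<not> b) else (f x, b))" for f
  have inv: "lift f (lift f z) = z" if "\<And>x. f (f x) = x" for f z
    using that by (cases z) (auto simp: lift_def)
  have free: "lift f z \<noteq> z" for f z
    by (cases z) (auto simp: lift_def)
  have "\<exists>s :: 'a \<times> bool \<Rightarrow> bool. \<forall>z. s (lift m z) \<noteq> s z \<and> s (lift p z) \<noteq> s z"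
    by (rule fixpoint_free_involutions_bipartite
        [OF inv[OF assms(1)] inv[OF assms(2)] free free])
  then obtain s :: "'a \<times> bool \<Rightarrow> bool"
    where s: "\<forall>z. s (lift m z) \<noteq> s z \<and> s (lift p z) \<noteq> s z"
    by (rule exE)
  have "(m x \<noteq> x \<longrightarrow> s (m x, True) \<noteq> s (x, True)) \<and>
      (p x \<noteq> x \<longrightarrow> s (p x, True) \<noteq> s (x, True))" for x
    using s[THEN spec, of "(x, True)"] by (auto simp: lift_def)
  then show ?thesis by (intro exI[of _ "\<lambda>x. s (x, True)"] allI)
qed

text \<open>The second involution \<open>p\<close> swaps one chosen pair in every class with at
  least two elements and fixes everything else. A bipartition for \<open>m\<close> and
  \<open>p\<close> together therefore takes both values on each such class.\<close>

lemma involution_bipartition_splitting_classes: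
  fixes m :: "'a \<Rightarrow> 'a" and lab :: "'a \<Rightarrow> 'v"
  assumes "\<And>x. m (m x) = x"
  shows "\<exists>s :: 'a \<Rightarrow> bool. (\<forall>x. m x \<noteq> x \<longrightarrow> s (m x) \<noteq> s x) \<and>
    (\<forall>x\<in>V. \<forall>y\<in>V. lab x = lab y \<and> x \<noteq> y \<longrightarrow>
      (\<exists>z\<in>V. \<exists>w\<in>V. lab z = lab x \<and> lab w = lab x \<and> s z \<and> \<not> s w))"
proof -
  define P where "P = (\<lambda>v. \<exists>x\<in>V. \<exists>y\<in>V. lab x = v \<and> lab y = v \<and> x \<noteq> y)"
  have "\<forall>v. \<exists>x y. P v \<longrightarrow> x \<in> V \<and> y \<in> V \<and> lab x = v \<and> lab y = v \<and> x \<noteq> y"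
    unfolding P_def by blast
  then obtain a b where ab: "\<And>v. P v \<Longrightarrow>
      a v \<in> V \<and> b v \<in> V \<and> lab (a v) = v \<and> lab (b v) = v \<and> a v \<noteq> b v"
    by metis
  define p where "p x = (if P (lab x) \<and> x = a (lab x) then b (lab x)
    else if P (lab x) \<and> x = b (lab x) then a (lab x) else x)" for x
  have pa: "p (a v) = b v" and pb: "p (b v) = a v" if "P v" for v
    using ab[OF that] that by (simp_all add: p_def)
  have p_other: "p x = x" if "\<not> (P (lab x) \<and> (x = a (lab x) \<or> x = b (lab x)))" for x
    using that unfolding p_def by argo
  have pp: "p (p x) = x" for x
    using pa[of "lab x"] pb[of "lab x"] p_other[of x] by metis
  obtain s :: "'a \<Rightarrow> bool" where
    s: "\<forall>x. (m x \<noteq> x \<longrightarrow> s (m x) \<noteq> s x) \<and> (p x \<noteq> x \<longrightarrow> s (p x) \<noteq> s x)"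
    using involutions_bipartite[of m p, OF assms pp] by (rule exE)
  have split: "s (a v) \<noteq> s (b v)" if "P v" for v
    using s[THEN spec, of "a v"] ab[OF that] pa[OF that] by metis
  have "\<exists>z\<in>V. \<exists>w\<in>V. lab z = v \<and> lab w = v \<and> s z \<and> \<not> s w" if "P v" for v
  proof (cases "s (a v)")
    case True
    with ab[OF that] split[OF that] show ?thesis
      by (intro bexI[of _ "a v"] bexI[of _ "b v"]) simp_all
  next
    case False
    with ab[OF that] split[OF that] show ?thesis
      by (intro bexI[of _ "b v"] bexI[of _ "a v"]) simp_all
  qed
  then have "\<forall>x\<in>V. \<forall>y\<in>V. lab x = lab y \<and> x \<noteq> y \<longrightarrow>
      (\<exists>z\<in>V. \<exists>w\<in>V. lab z = lab x \<and> lab w = lab x \<and> s z \<and> \<not> s w)"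
    unfolding P_def by simp metis
  moreover have "\<forall>x. m x \<noteq> x \<longrightarrow> s (m x) \<noteq> s x"
    using s by simp
  ultimately show ?thesis by (intro exI[of _ s] conjI)
qed

section \<open>Colouring a matching together with cliques of bounded size\<close>

text \<open>The pairs moved by \<open>m\<close> stand for the matching edges and the classes of
  \<open>lab\<close> for the clusters. The set \<open>V\<close> need not be closed under
  \<open>m\<close>, so the induction can delete vertices without changing \<open>m\<close>.\<close>

lemma involution_classes_colouring:
  fixes m :: "'a \<Rightarrow> 'a" and lab :: "'a \<Rightarrow> 'v" and d :: nat
  assumes "2 \<le> d" and mm: "\<And>x. m (m x) = x"
    and "\<And>v. finite {x \<in> V. lab x = v}" and "\<And>v. card {x \<in> V. lab x = v} \<le> d"
  shows "\<exists>c :: 'a \<Rightarrow> nat. (\<forall>x\<in>V. c x < d) \<and>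
    (\<forall>x\<in>V. \<forall>y\<in>V. x \<noteq> y \<and> (m x = y \<or> lab x = lab y) \<longrightarrow> c x \<noteq> c y)"
  using assms(1,3,4)
proof (induction d arbitrary: V rule: dec_induct)
  case base
  obtain s :: "'a \<Rightarrow> bool" where s: "\<forall>x. m x \<noteq> x \<longrightarrow> s (m x) \<noteq> s x"
    and split: "\<forall>x\<in>V. \<forall>y\<in>V. lab x = lab y \<and> x \<noteq> y \<longrightarrow>
      (\<exists>z\<in>V. \<exists>w\<in>V. lab z = lab x \<and> lab w = lab x \<and> s z \<and> \<not> s w)"
    using involution_bipartition_splitting_classes[of m V lab, OF mm] by (elim exE conjE)
  have same: "s x \<noteq> s y" if xy: "x \<in> V" "y \<in> V" "lab x = lab y" "x \<noteq> y" for x y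
  proof -
    let ?C = "{z \<in> V. lab z = lab x}"
    \<comment> \<open>A class of size at most two is exhausted by \<open>x\<close> and
      \<open>y\<close>; since \<open>s\<close> takes both values on it, \<open>s\<close> separates
      them.\<close>
    have "{x, y} = ?C"
      by (rule card_seteq) (use xy base(1,2)[of "lab x"] in auto)
    then have "z = x \<or> z = y" if "z \<in> V" "lab z = lab x" for z
      using that by blast
    moreover obtain z w where "z \<in> V" "w \<in> V" "lab z = lab x" "lab w = lab x" "s z" "\<not> s w"
      using split xy by blast
    ultimately show ?thesis by metis
  qed
  have "s x \<noteq> s y" if "x \<in> V" "y \<in> V" "x \<noteq> y \<and> (m x = y \<or> lab x = lab y)" for x y
    using that same[of x y] s[THEN spec, of x] by metis
  then have "\<forall>x\<in>V. \<forall>y\<in>V. x \<noteq> y \<and> (m x = y \<or> lab x = lab y) \<longrightarrow>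
      of_bool (s x) \<noteq> (of_bool (s y) :: nat)"
    unfolding of_bool_eq_iff by (intro ballI impI)
  moreover have "\<forall>x\<in>V. of_bool (s x) < (2 :: nat)" by simp
  ultimately show ?case by (intro exI[of _ "\<lambda>x. of_bool (s x)"] conjI)
next
  case (step d)
  obtain s :: "'a \<Rightarrow> bool" where s: "\<forall>x. m x \<noteq> x \<longrightarrow> s (m x) \<noteq> s x"
    and split: "\<forall>x\<in>V. \<forall>y\<in>V. lab x = lab y \<and> x \<noteq> y \<longrightarrow>
      (\<exists>z\<in>V. \<exists>w\<in>V. lab z = lab x \<and> lab w = lab x \<and> s z \<and> \<not> s w)"
    using involution_bipartition_splitting_classes[of m V lab, OF mm] by (elim exE conjE)
  define t where "t = (\<lambda>v. SOME z. z \<in> V \<and> lab z = v \<and> s z)"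
  \<comment> \<open>The condition \<open>s x\<close> ensures that the class of \<open>x\<close> has
    a true vertex, so the arbitrary value of \<open>t\<close> on other classes does no harm.
    \<open>U\<close> has at most one vertex in each class.\<close>
  define U where "U = {x \<in> V. s x \<and> x = t (lab x)}"
  have U_meets: "\<exists>z\<in>U. lab z = lab x" if "x \<in> V" "y \<in> V" "lab x = lab y" "x \<noteq> y" for x y
  proof -
    have "\<exists>z. z \<in> V \<and> lab z = lab x \<and> s z"
      using split that by blast
    then have "t (lab x) \<in> V \<and> lab (t (lab x)) = lab x \<and> s (t (lab x))"
      unfolding t_def by (rule someI_ex)
    then show ?thesis
      unfolding U_def by (intro bexI[of _ "t (lab x)"]) simp_all
  qed
  have fin: "finite {x \<in> V - U. lab x = v}" for v
    by (rule finite_subset[OF _ step.prems(1)[of v]]) auto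
  have "card {x \<in> V - U. lab x = v} \<le> d" for v
  proof (rule ccontr)
    let ?C = "{x \<in> V. lab x = v}" and ?D = "{x \<in> V - U. lab x = v}"
    assume "\<not> ?thesis"
    \<comment> \<open>A class that is still too large has lost no vertex to \<open>U\<close>. As
      \<open>d \<ge> 2\<close> it contains two vertices, so \<open>U\<close> meets it, a
      contradiction.\<close>
    then have D: "Suc d \<le> card ?D" by simp
    with step.prems(2)[of v] have "card ?C \<le> card ?D" by (rule order_trans)
    then have DC: "?D = ?C"
      by (intro card_seteq step.prems(1)) blast+
    have "\<exists>x\<in>?D. \<exists>y\<in>?D. x \<noteq> y"
    proof (rule ccontr)
      assume "\<not> ?thesis"
      then have "card ?D \<le> Suc 0"
        unfolding card_le_Suc0_iff_eq[OF fin] by metis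
      with D step.hyps(1) show False by simp
    qed
    then obtain x y where "x \<in> ?D" "y \<in> ?D" "x \<noteq> y" by (elim bexE)
    then obtain z where "z \<in> U" "lab z = v"
      using U_meets[of x y] by auto
    moreover from this have "z \<in> ?C" unfolding U_def by blast
    ultimately show False using DC by blast
  qed
  from step.IH[OF fin this] obtain c
    where c: "\<And>x. x \<in> V - U \<Longrightarrow> c x < d"
      "\<And>x y. \<lbrakk>x \<in> V - U; y \<in> V - U; x \<noteq> y; m x = y \<or> lab x = lab y\<rbrakk> \<Longrightarrow> c x \<noteq> c y"
    by blast
  have indep: "\<not> (m x = y \<or> lab x = lab y)" if "x \<in> U" "y \<in> U" "x \<noteq> y" for x y
  proof -
    \<comment> \<open>Equal labels would give the same representative, and \<open>m\<close> joins
      only vertices with different values of \<open>s\<close>.\<close>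
    have "s x" "s y" "x = t (lab x)" "y = t (lab y)"
      using that(1,2) by (simp_all only: U_def mem_Collect_eq)
    with s[THEN spec, of x] that(3) show ?thesis by metis
  qed
  let ?c = "\<lambda>x. if x \<in> U then d else c x"
  have "?c x < Suc d" if "x \<in> V" for x
    using c(1)[of x] that by auto
  moreover have "?c x \<noteq> ?c y" if "x \<in> V" "y \<in> V" "x \<noteq> y" "m x = y \<or> lab x = lab y" for x y
    using that c(1)[of x] c(1)[of y] c(2)[of x y] indep[of x y] by auto
  ultimately show ?case
    by (intro exI[of _ ?c]) blast
qed

section \<open>Matching and clusters of a truncation\<close>

lemma matching_involution:
  assumes "matching M"
  shows "\<exists>m. (\<forall>x. m (m x) = x) \<and> (\<forall>x y. {x, y} \<in> M \<longrightarrow> m x = y)"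
proof -
  have uniq: "y = z" if "{x, y} \<in> M" "{x, z} \<in> M" for x y z
  proof -
    have "{x, y} \<inter> {x, z} \<noteq> {}" by simp
    with assms that have "{x, y} = {x, z}"
      unfolding matching_def by metis
    then show ?thesis by (auto simp: doubleton_eq_iff)
  qed
  \<comment> \<open>Unmatched vertices are fixed, which makes \<open>m\<close> an involution on the
    whole type.\<close>
  define m where "m x = (if \<exists>y. {x, y} \<in> M then THE y. {x, y} \<in> M else x)" for x
  have m: "m x = y" if "{x, y} \<in> M" for x y
  proof -
    have "(THE z. {x, z} \<in> M) = y"
      by (rule the_equality, rule that, rule uniq[OF _ that])
    then show ?thesis using that by (auto simp: m_def)
  qed
  have "m (m x) = x" for x
  proof (cases "\<exists>y. {x, y} \<in> M")
    case True
    then obtain y where y: "{x, y} \<in> M" by blast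
    then have "{y, x} \<in> M" by (simp add: insert_commute)
    then show ?thesis using m[OF y] m[of y x] by simp
  next
    case False
    then show ?thesis by (simp add: m_def)
  qed
  then have "\<forall>x. m (m x) = x" by (rule allI)
  moreover have "\<forall>x y. {x, y} \<in> M \<longrightarrow> m x = y" using m by iprover
  ultimately show ?thesis by (intro exI[of _ m] conjI)
qed

text \<open>Exactly one end of \<open>F e\<close> carries the label \<open>v\<close> when
  \<open>e\<close> is incident with \<open>v\<close>, and different edges have disjoint images. A
  bijection, rather than an equation of cardinalities, also transfers finiteness.\<close>

lemma cluster_equipotent_incident_edges:
  assumes "multigraph X" and "generalized_truncation X M F lab con Y"
  shows "\<exists>g. bij_betw g (incident_edges X v) (cluster M lab v)"
proof -
  have FM: "bij_betw F (medges X) M" and M: "matching M"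
    and lab: "\<And>e. e \<in> medges X \<Longrightarrow> lab ` F e = ends X e"
    using assms(2) by (auto simp: generalized_truncation_def)
  have inj: "inj_on lab (F e)" if "e \<in> medges X" for e
  proof -
    have two: "card (F e) = 2"
      using M FM that by (auto simp: matching_def bij_betw_def)
    moreover have "card (lab ` F e) = 2"
      using assms(1) lab that by (auto simp: multigraph_def)
    moreover have "finite (F e)"
      using two by (intro card_ge_0_finite) simp
    ultimately show ?thesis
      by (intro eq_card_imp_inj_on) simp_all
  qed
  define g where "g e = inv_into (F e) lab v" for e
  have g: "g e \<in> F e" "lab (g e) = v" if "e \<in> incident_edges X v" for e
    using that lab[of e] unfolding g_def incident_edges_def
    by (metis (lifting) inv_into_into mem_Collect_eq, metis (lifting) f_inv_into_f mem_Collect_eq)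
  have same: "e = f" if "e \<in> medges X" "f \<in> medges X" "x \<in> F e" "x \<in> F f" for e f x
  proof -
    have "F e = F f"
      using M bij_betwE[OF FM] that unfolding matching_def by blast
    then show ?thesis
      using FM that by (meson bij_betw_imp_inj_on inj_onD)
  qed
  have "inj_on g (incident_edges X v)"
  proof (rule inj_onI)
    fix e f assume ef: "e \<in> incident_edges X v" "f \<in> incident_edges X v" "g e = g f"
    then have "g e \<in> F e" "g e \<in> F f"
      using g(1)[of e] g(1)[of f] by auto
    with ef same show "e = f" by (auto simp: incident_edges_def)
  qed
  moreover have "g ` incident_edges X v = cluster M lab v"
  proof
    show "g ` incident_edges X v \<subseteq> cluster M lab v"
      using g bij_betwE[OF FM] by (auto simp: cluster_def incident_edges_def)
    show "cluster M lab v \<subseteq> g ` incident_edges X v"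
    proof
      fix x assume "x \<in> cluster M lab v"
      then obtain e where e: "e \<in> medges X" "x \<in> F e" "lab x = v"
        using bij_betw_imp_surj_on[OF FM] by (auto simp: cluster_def)
      then have "e \<in> incident_edges X v"
        using lab[of e] by (auto simp: incident_edges_def)
      moreover from this have "g e = x"
        using g e inj by (metis inj_onD)
      ultimately show "x \<in> g ` incident_edges X v" by blast
    qed
  qed
  ultimately show ?thesis
    by (auto simp: bij_betw_def)
qed

section \<open>Chromatic number of the complete truncation\<close>

theorem theorem7p4:
  fixes X :: "('v, 'e) mgraph" and Y :: "'a sgraph" and d :: nat
  assumes "multigraph X"
    and "has_max_valency X d"
    and "d > 1"
    and "complete_generalized_truncation X Y"
  shows "chromatic_number Y = enat d"
proof -
  obtain M F lab con where T: "generalized_truncation X M F lab con Y"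
    and complete: "\<And>v. v \<in> mverts X \<Longrightarrow> complete_graph (con v)"
    using assms(4) by (auto simp: complete_generalized_truncation_def)
  have M: "matching M" and VY: "sverts Y = \<Union>M"
    and EY: "sedges Y = M \<union> (\<Union>v\<in>mverts X. sedges (con v))"
    and con: "\<And>v. v \<in> mverts X \<Longrightarrow> simple_graph (con v) \<and> sverts (con v) = cluster M lab v"
    using T by (auto simp: generalized_truncation_def)
  have card_cluster: "card (cluster M lab v) = valency X v"
    and fin_cluster: "finite (cluster M lab v) \<longleftrightarrow> finite (incident_edges X v)" for v
    using cluster_equipotent_incident_edges[OF assms(1) T, of v]
    unfolding valency_def by (metis bij_betw_same_card, metis bij_betw_finite)
  \<comment> \<open>The colouring lemma needs bounds for all labels, so labels outside
    \<open>mverts X\<close> are covered too: their clusters are empty.\<close>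
  have outside: "incident_edges X v = {}" if "v \<notin> mverts X" for v
    using assms(1) that by (auto simp: multigraph_def incident_edges_def)
  have fin: "finite (cluster M lab v)" and le: "card (cluster M lab v) \<le> d" for v
    using assms(2) outside[of v]
    by (cases "v \<in> mverts X"; simp add: has_max_valency_def fin_cluster card_cluster valency_def)+
  obtain m where mm: "\<And>x. m (m x) = x" and mM: "\<And>x y. {x, y} \<in> M \<Longrightarrow> m x = y"
    using matching_involution[OF M] by blast
  have "2 \<le> d" using assms(3) by simp
  then obtain c where c: "\<And>x. x \<in> \<Union>M \<Longrightarrow> c x < d"
    "\<And>x y. \<lbrakk>x \<in> \<Union>M; y \<in> \<Union>M; x \<noteq> y; m x = y \<or> lab x = lab y\<rbrakk> \<Longrightarrow> c x \<noteq> c y"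
    using involution_classes_colouring[of d m "\<Union>M" lab, OF _ mm fin[unfolded cluster_def]
        le[unfolded cluster_def]]
    by blast
  have "c x \<noteq> c y" if xy: "x \<in> sverts Y" "y \<in> sverts Y" "{x, y} \<in> sedges Y" for x y
  proof -
    \<comment> \<open>\<open>proper_colouring\<close> also ranges over \<open>x = y\<close>; this
      case is ruled out because every edge has two elements.\<close>
    have "card {x, y} = 2"
      using xy(3) M con unfolding EY matching_def simple_graph_def by blast
    then have "x \<noteq> y" by auto
    moreover have "m x = y \<or> lab x = lab y"
    proof (cases "{x, y} \<in> M")
      case False
      then obtain v where v: "v \<in> mverts X" "{x, y} \<in> sedges (con v)"
        using xy(3) EY by blast
      then have "{x, y} \<subseteq> cluster M lab v"
        using con[OF v(1)] unfolding simple_graph_def by metis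
      then show ?thesis by (auto simp: cluster_def)
    qed (simp add: mM)
    ultimately show ?thesis using c(2)[of x y] xy VY by simp
  qed
  then have upper: "proper_colouring Y d c"
    using c(1) VY by (auto simp: proper_colouring_def)
  have lower: "d \<le> k" if k: "proper_colouring Y k c'" for k c'
  proof -
    obtain v where v: "v \<in> mverts X" "card (cluster M lab v) = d"
      using assms(2) by (auto simp: has_max_valency_def card_cluster)
    have sub: "cluster M lab v \<subseteq> sverts Y"
      by (auto simp: cluster_def VY)
    \<comment> \<open>Completeness of \<open>con v\<close> makes the cluster a clique, so its
      \<open>d\<close> vertices receive distinct colours.\<close>
    have "inj_on c' (cluster M lab v)"
    proof (rule inj_onI, rule ccontr)
      fix x y assume xy: "x \<in> cluster M lab v" "y \<in> cluster M lab v" "c' x = c' y" "x \<noteq> y"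
      then have "{x, y} \<in> sedges Y"
        using complete[OF v(1)] con[OF v(1)] v(1) unfolding complete_graph_def EY by blast
      with k xy sub show False unfolding proper_colouring_def by blast
    qed
    moreover have "c' ` cluster M lab v \<subseteq> {..<k}"
      using k sub by (auto simp: proper_colouring_def)
    ultimately have "card (cluster M lab v) \<le> card {..<k}"
      by (intro card_inj_on_le[of c']) auto
    with v(2) show ?thesis by simp
  qed
  show ?thesis
    unfolding chromatic_number_def
    by (rule antisym) (use upper lower in \<open>auto intro!: Inf_lower Inf_greatest\<close>)
qed

end
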